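(* Let $\varphi$ be a continuous t-norm, let $c\in\mathbb{R}_{\ge0}^n$, let $\mathcal{C}$ be a CNF formula with $m$ clauses in $n$ Boolean variables, let $A^+,A^-\in\{0,1\}^{m\times n}$ be its crisp incidence matrices, and let $b=\mathbf{1}=(1,\dots,1)^T$. Let $F$ be the set of $x\in[0,1]^n$ with $\max_{1\le j\le n}\max\{\varphi(a^+_{ij},x_j),\varphi(a^-_{ij},1-x_j)\}=1$ for all $i=1,\dots,m$. Then for every $x\in F$ there exists a Boolean vector $y\in F\cap\{0,1\}^n$ such that $c^Ty\le c^Tx$. Consequently, $$\min\{c^Tx: x\in F\}=\min\{c^Ty: y\in\{0,1\}^n,\ y\models\mathcal{C}\},$$ and whenever $F\neq\varnothing$ there exists a Boolean vector that is a global minimizer of $c^Tx$ over $F$.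
   Context: A t-norm is a map $\varphi:[0,1]^2\to[0,1]$ that is commutative, associative, non-decreasing in each argument, and satisfies $\varphi(1,z)=z$ for all $z$ (hence $\varphi(0,z)=0$). Let $\mathcal{C}=C_1\wedge\cdots\wedge C_m$ with $C_i=\bigvee_{j\in P_i}y_j\vee\bigvee_{j\in N_i}\neg y_j$, $P_i,N_i\subseteq\{1,\dots,n\}$. Its crisp incidence matrices are given by $a^+_{ij}=1$ if $j\in P_i$ and $0$ otherwise, and $a^-_{ij}=1$ if $j\in N_i$ and $0$ otherwise. $y\models\mathcal{C}$ means that $y$ satisfies $\mathcal{C}$; empty clauses are unsatisfiable. A minimum over an empty set is taken to be $+\infty$. *)

theory Defs
  imports Complex_Main "HOL-Library.Extended_Real" "Jordan_Normal_Form.Matrix"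
begin

text \<open>A t-norm is modelled by a function on all of \<open>\<real>\<^sup>2\<close>; only its restriction to the unit
  square is constrained.\<close>

definition t_norm :: "(real \<Rightarrow> real \<Rightarrow> real) \<Rightarrow> bool" where
  "t_norm \<phi> \<longleftrightarrow>
     (\<forall>u\<in>{0..1}. \<forall>v\<in>{0..1}. \<phi> u v \<in> {0..1}) \<and>
     (\<forall>u\<in>{0..1}. \<forall>v\<in>{0..1}. \<phi> u v = \<phi> v u) \<and>
     (\<forall>u\<in>{0..1}. \<forall>v\<in>{0..1}. \<forall>w\<in>{0..1}. \<phi> (\<phi> u v) w = \<phi> u (\<phi> v w)) \<and>
     (\<forall>u\<in>{0..1}. \<forall>u'\<in>{0..1}. \<forall>v\<in>{0..1}. \<forall>v'\<in>{0..1}. u \<le> u' \<longrightarrow> v \<le> v' \<longrightarrow> \<phi> u v \<le> \<phi> u' v') \<and>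
     (\<forall>z\<in>{0..1}. \<phi> 1 z = z)"

definition continuous_t_norm :: "(real \<Rightarrow> real \<Rightarrow> real) \<Rightarrow> bool" where
  "continuous_t_norm \<phi> \<longleftrightarrow> t_norm \<phi> \<and> continuous_on ({0..1} \<times> {0..1}) (\<lambda>(u, v). \<phi> u v)"

text \<open>A clause is the pair \<open>(P, N)\<close> of the index sets of its positive and negative literals,
  which need not be disjoint. Variables and clauses are numbered from 0.\<close>

type_synonym clause = "nat set \<times> nat set"
type_synonym cnf = "clause list"

definition is_cnf :: "nat \<Rightarrow> nat \<Rightarrow> cnf \<Rightarrow> bool" where
  "is_cnf m n C \<longleftrightarrow> length C = m \<and> (\<forall>(P, N) \<in> set C. P \<subseteq> {..<n} \<and> N \<subseteq> {..<n})"

definition pos_incidence :: "nat \<Rightarrow> cnf \<Rightarrow> real mat" where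
  "pos_incidence n C = mat (length C) n (\<lambda>(i, j). if j \<in> fst (C ! i) then 1 else 0)"

definition neg_incidence :: "nat \<Rightarrow> cnf \<Rightarrow> real mat" where
  "neg_incidence n C = mat (length C) n (\<lambda>(i, j). if j \<in> snd (C ! i) then 1 else 0)"

definition unit_cube :: "nat \<Rightarrow> real vec set" where
  "unit_cube n = {x \<in> carrier_vec n. \<forall>j<n. x $ j \<in> {0..1}}"

definition boolean_vecs :: "nat \<Rightarrow> real vec set" where
  "boolean_vecs n = {y \<in> carrier_vec n. \<forall>j<n. y $ j \<in> {0, 1}}"

definition sat_clause :: "real vec \<Rightarrow> clause \<Rightarrow> bool" where
  "sat_clause y = (\<lambda>(P, N). (\<exists>j\<in>P. y $ j = 1) \<or> (\<exists>j\<in>N. y $ j = 0))"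

definition satisfies :: "real vec \<Rightarrow> cnf \<Rightarrow> bool" (infix "\<Turnstile>" 50) where
  "y \<Turnstile> C \<longleftrightarrow> (\<forall>D \<in> set C. sat_clause y D)"

text \<open>All values involved lie in \<open>[0,1]\<close>, so for \<open>n = 0\<close> the maximum over the empty index
  range is the least element 0. An equation with right-hand side 1 is then unsolvable, in agreement
  with the unsatisfiability of the empty clause.\<close>

definition max_below :: "nat \<Rightarrow> (nat \<Rightarrow> real) \<Rightarrow> real" where
  "max_below n f = (if n = 0 then 0 else Max (f ` {..<n}))"

definition solution_set ::
  "(real \<Rightarrow> real \<Rightarrow> real) \<Rightarrow> nat \<Rightarrow> nat \<Rightarrow> real mat \<Rightarrow> real mat \<Rightarrow> real vec \<Rightarrow> real vec set" where
  "solution_set \<phi> m n A\<^sub>p A\<^sub>n b =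
     {x \<in> unit_cube n. \<forall>i<m.
        max_below n (\<lambda>j. max (\<phi> (A\<^sub>p $$ (i, j)) (x $ j)) (\<phi> (A\<^sub>n $$ (i, j)) (1 - x $ j))) = b $ i}"

text \<open>\<open>is_minimum S v\<close>: the minimum of \<open>S\<close> exists and equals \<open>v\<close>. It must be attained, except that
  the minimum of the empty set is \<open>\<infinity>\<close> by convention.\<close>

definition is_minimum :: "real set \<Rightarrow> ereal \<Rightarrow> bool" where
  "is_minimum S v \<longleftrightarrow>
     (if S = {} then v = \<infinity> else \<exists>s\<in>S. v = ereal s \<and> (\<forall>t\<in>S. s \<le> t))"

end

theory Submission imports Defs
begin

text \<open>On the points \<open>0\<close> and \<open>1\<close> a t-norm is forced: \<open>\<phi> 1 z = z\<close> and \<open>\<phi> 0 z = 0\<close>. The incidence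
  matrices are crisp, so every left-hand side is a maximum of terms \<open>x $ j\<close> for \<open>j \<in> P\<close>,
  \<open>1 - x $ j\<close> for \<open>j \<in> N\<close>, and zeros. All of them are at most 1, hence the maximum
  equals 1 exactly if some \<open>x $ j = 1\<close> with \<open>j \<in> P\<close> or some \<open>x $ j = 0\<close> with \<open>j \<in> N\<close>. This is
  literally the satisfaction condition of the clause, read at a point of the cube that may have
  fractional coordinates. Thus the feasible set is \<open>{x \<in> unit_cube n. x \<Turnstile> C}\<close>
  (\<open>solution_set_eq_satisfying\<close>).

  Coordinates strictly between 0 and 1 witness no literal. Rounding the whole point down
  therefore keeps every witness, so satisfaction is preserved, and the cost cannot grow since
  \<open>c\<close> is nonnegative. The Boolean satisfying assignments are thus a finite subset of the feasible
  set, and below every feasible cost lies the cost of one of them; both sets have the same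
  minimum, attained at a Boolean vector as soon as there is a feasible point.\<close>

lemma t_norm_zero_left:
  assumes "t_norm \<phi>" and "z \<in> {0..1}"
  shows "\<phi> 0 z = 0"
proof -
  have mono: "\<phi> u v \<le> \<phi> u' v'"
    if "u \<in> {0..1}" "u' \<in> {0..1}" "v \<in> {0..1}" "v' \<in> {0..1}" "u \<le> u'" "v \<le> v'" for u u' v v'
    using assms(1) that unfolding t_norm_def by blast
  have "\<phi> 0 z \<le> \<phi> 0 1"
    using assms(2) by (intro mono) auto
  also have "\<phi> 0 1 = \<phi> 1 0"
    using assms(1) unfolding t_norm_def by auto
  also have "\<phi> 1 0 = 0"
    using assms(1) unfolding t_norm_def by auto
  moreover have "\<phi> 0 z \<in> {0..1}"
    using assms unfolding t_norm_def by auto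
  ultimately show ?thesis
    by simp
qed

lemma t_norm_one_left:
  assumes "t_norm \<phi>" and "z \<in> {0..1}"
  shows "\<phi> 1 z = z"
  using assms unfolding t_norm_def by blast

lemma max_below_eq_one_iff:
  assumes "\<And>j. j < n \<Longrightarrow> f j \<le> 1"
  shows "max_below n f = 1 \<longleftrightarrow> (\<exists>j<n. f j = 1)"
proof (cases "n = 0")
  case False
  then have "f ` {..<n} \<noteq> {}"
    by auto
  then have "max_below n f = 1 \<longleftrightarrow> 1 \<in> f ` {..<n} \<and> (\<forall>a \<in> f ` {..<n}. a \<le> 1)"
    using False by (simp add: max_below_def Max_eq_iff)
  then show ?thesis
    using assms by (auto simp: image_iff)
qed (simp add: max_below_def)

text \<open>The left-hand side with \<open>p\<close> and \<open>q\<close> for the two clause memberships of a variable with value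
  \<open>z\<close>.\<close>

lemma crisp_literal_term:
  fixes p q :: bool and z :: real
  assumes "t_norm \<phi>" and "z \<in> {0..1}"
  defines "t \<equiv> max (\<phi> (if p then 1 else 0) z) (\<phi> (if q then 1 else 0) (1 - z))"
  shows "t \<le> 1" and "t = 1 \<longleftrightarrow> p \<and> z = 1 \<or> q \<and> z = 0"
proof -
  have "1 - z \<in> {0..1}"
    using assms(2) by simp
  then have "t = max (if p then z else 0) (if q then 1 - z else 0)"
    using assms(1,2) by (simp add: t_def t_norm_zero_left t_norm_one_left)
  then show "t \<le> 1" and "t = 1 \<longleftrightarrow> p \<and> z = 1 \<or> q \<and> z = 0"
    using assms(2) by (auto simp: max_def)
qed

lemma row_equation_iff_sat_clause:
  assumes "t_norm \<phi>" and "x \<in> unit_cube n" and "i < length C"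
    and "fst (C ! i) \<subseteq> {..<n}" and "snd (C ! i) \<subseteq> {..<n}"
  shows "max_below n (\<lambda>j. max (\<phi> (pos_incidence n C $$ (i, j)) (x $ j))
                              (\<phi> (neg_incidence n C $$ (i, j)) (1 - x $ j))) = 1
         \<longleftrightarrow> sat_clause x (C ! i)"
proof -
  let ?t = "\<lambda>j. max (\<phi> (pos_incidence n C $$ (i, j)) (x $ j))
                    (\<phi> (neg_incidence n C $$ (i, j)) (1 - x $ j))"
  have t: "?t j \<le> 1"
      "?t j = 1 \<longleftrightarrow> j \<in> fst (C ! i) \<and> x $ j = 1 \<or> j \<in> snd (C ! i) \<and> x $ j = 0" if "j < n" for j
  proof -
    have "x $ j \<in> {0..1}"
      using assms(2) that by (auto simp: unit_cube_def)
    note crisp_literal_term[OF assms(1) this, of "j \<in> fst (C ! i)" "j \<in> snd (C ! i)"]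
    then show "?t j \<le> 1"
        "?t j = 1 \<longleftrightarrow> j \<in> fst (C ! i) \<and> x $ j = 1 \<or> j \<in> snd (C ! i) \<and> x $ j = 0"
      using assms(3) that by (simp_all add: pos_incidence_def neg_incidence_def)
  qed
  have "max_below n ?t = 1 \<longleftrightarrow> (\<exists>j<n. ?t j = 1)"
    using t(1) by (rule max_below_eq_one_iff)
  also have "\<dots> \<longleftrightarrow> (\<exists>j<n. j \<in> fst (C ! i) \<and> x $ j = 1 \<or> j \<in> snd (C ! i) \<and> x $ j = 0)"
    using t(2) by blast
  also have "\<dots> \<longleftrightarrow> sat_clause x (C ! i)"
    using assms(4,5) by (auto simp: sat_clause_def split: prod.splits)
  finally show ?thesis .
qed

lemma solution_set_eq_satisfying:
  assumes "t_norm \<phi>" and "is_cnf m n C"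
  shows "solution_set \<phi> m n (pos_incidence n C) (neg_incidence n C) (vec m (\<lambda>_. 1))
         = {x \<in> unit_cube n. x \<Turnstile> C}"
proof -
  have len: "length C = m"
    using assms(2) by (simp add: is_cnf_def)
  have vars: "fst (C ! i) \<subseteq> {..<n}" "snd (C ! i) \<subseteq> {..<n}" if "i < m" for i
  proof -
    have "C ! i \<in> set C"
      using that len by simp
    then show "fst (C ! i) \<subseteq> {..<n}" "snd (C ! i) \<subseteq> {..<n}"
      using assms(2) by (auto simp: is_cnf_def split_beta)
  qed
  have "x \<Turnstile> C \<longleftrightarrow> (\<forall>i<m. sat_clause x (C ! i))" for x
    using len by (auto simp: satisfies_def all_set_conv_all_nth)
  then show ?thesis
    using row_equation_iff_sat_clause[OF assms(1)] vars len
    by (auto simp: solution_set_def)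
qed

definition floor_vec :: "real vec \<Rightarrow> real vec" where
  "floor_vec = map_vec (\<lambda>t. of_int \<lfloor>t\<rfloor>)"

lemma floor_vec_boolean:
  assumes "x \<in> unit_cube n"
  shows "floor_vec x \<in> boolean_vecs n"
proof -
  have "\<lfloor>t\<rfloor> = 0 \<or> \<lfloor>t\<rfloor> = 1" if "t \<in> {0..1}" for t :: real
    using that by (auto simp: floor_eq_iff)
  then show ?thesis
    using assms by (fastforce simp: floor_vec_def unit_cube_def boolean_vecs_def)
qed

text \<open>A literal is witnessed only by a coordinate that is already 0 or 1, and such coordinates
  are fixed by rounding.\<close>

lemma floor_vec_satisfies:
  assumes "x \<in> unit_cube n" and "is_cnf m n C" and "x \<Turnstile> C"
  shows "floor_vec x \<Turnstile> C"
  unfolding satisfies_def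
proof
  fix D assume "D \<in> set C"
  then have vars: "fst D \<subseteq> {..<n}" "snd D \<subseteq> {..<n}" and sat: "sat_clause x D"
    using assms(2,3) by (auto simp: is_cnf_def satisfies_def split_beta)
  have "floor_vec x $ j = of_int \<lfloor>x $ j\<rfloor>" if "j < n" for j
    using assms(1) that by (auto simp: floor_vec_def unit_cube_def)
  then show "sat_clause (floor_vec x) D"
    using vars sat by (force simp: sat_clause_def split: prod.splits)
qed

lemma scalar_prod_floor_vec_le:
  assumes "c \<in> carrier_vec n" and "\<forall>j<n. 0 \<le> c $ j" and "x \<in> carrier_vec n"
  shows "c \<bullet> floor_vec x \<le> c \<bullet> x"
  using assms by (auto simp: scalar_prod_def floor_vec_def intro!: sum_mono mult_left_mono)

lemma finite_boolean_vecs: "finite (boolean_vecs n)"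
proof (rule finite_subset)
  show "boolean_vecs n \<subseteq> (\<lambda>S. vec n (\<lambda>j. if j \<in> S then 1 else 0)) ` Pow {..<n}"
  proof
    fix y assume "y \<in> boolean_vecs n"
    then have "y = vec n (\<lambda>j. if j \<in> {j. j < n \<and> y $ j = 1} then 1 else 0)"
      by (intro eq_vecI) (auto simp: boolean_vecs_def)
    then show "y \<in> (\<lambda>S. vec n (\<lambda>j. if j \<in> S then 1 else 0)) ` Pow {..<n}"
      by blast
  qed
qed simp

text \<open>Domination by a finite subset is what makes the minimum over the possibly infinite set
  exist.\<close>

lemma common_minimum_of_dominating_subset:
  assumes "finite T" and "T \<subseteq> S" and dom: "\<And>s. s \<in> S \<Longrightarrow> \<exists>t\<in>T. t \<le> s"
  shows "\<exists>v. is_minimum S v \<and> is_minimum T v"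
proof (cases "T = {}")
  case True
  then have "S = {}"
    using dom by blast
  with True show ?thesis
    by (simp add: is_minimum_def)
next
  case False
  then have "Min T \<in> T" and "\<And>t. t \<in> T \<Longrightarrow> Min T \<le> t"
    using assms(1) by simp_all
  moreover from this have "\<And>s. s \<in> S \<Longrightarrow> Min T \<le> s"
    using dom by (meson order_trans)
  ultimately have "is_minimum S (ereal (Min T)) \<and> is_minimum T (ereal (Min T))"
    using assms(2) by (auto simp: is_minimum_def)
  then show ?thesis
    by blast
qed

theorem theorem4:
  fixes \<phi> :: "real \<Rightarrow> real \<Rightarrow> real" and m n :: nat and c :: "real vec" and C :: cnf
    and F :: "real vec set"
  assumes "continuous_t_norm \<phi>"
    and "c \<in> carrier_vec n" and "\<forall>j<n. 0 \<le> c $ j"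
    and "is_cnf m n C"
    and "F = solution_set \<phi> m n (pos_incidence n C) (neg_incidence n C) (vec m (\<lambda>_. 1))"
  shows "(\<forall>x\<in>F. \<exists>y \<in> F \<inter> boolean_vecs n. c \<bullet> y \<le> c \<bullet> x) \<and>
    (\<exists>v. is_minimum {c \<bullet> x | x. x \<in> F} v \<and>
         is_minimum {c \<bullet> y | y. y \<in> boolean_vecs n \<and> y \<Turnstile> C} v) \<and>
    (F \<noteq> {} \<longrightarrow> (\<exists>y \<in> boolean_vecs n. is_arg_min (\<lambda>x. c \<bullet> x) (\<lambda>x. x \<in> F) y))"
proof -
  have F: "F = {x \<in> unit_cube n. x \<Turnstile> C}"
    using assms(1,4,5) by (simp add: continuous_t_norm_def solution_set_eq_satisfying)
  have "boolean_vecs n \<subseteq> unit_cube n"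
    by (force simp: boolean_vecs_def unit_cube_def)
  then have bool: "F \<inter> boolean_vecs n = {y \<in> boolean_vecs n. y \<Turnstile> C}"
    using F by blast
  have round: "\<exists>y \<in> F \<inter> boolean_vecs n. c \<bullet> y \<le> c \<bullet> x" if "x \<in> F" for x
  proof
    have x: "x \<in> unit_cube n" "x \<Turnstile> C"
      using that F by auto
    then show "c \<bullet> floor_vec x \<le> c \<bullet> x"
      using assms(2,3) by (intro scalar_prod_floor_vec_le) (auto simp: unit_cube_def)
    show "floor_vec x \<in> F \<inter> boolean_vecs n"
      unfolding bool using x assms(4) floor_vec_boolean floor_vec_satisfies by blast
  qed
  let ?S = "{c \<bullet> x | x. x \<in> F}" and ?T = "{c \<bullet> y | y. y \<in> boolean_vecs n \<and> y \<Turnstile> C}"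
  have T: "?T = (\<lambda>y. c \<bullet> y) ` (F \<inter> boolean_vecs n)"
    unfolding bool by blast
  have "\<exists>v. is_minimum ?S v \<and> is_minimum ?T v"
  proof (rule common_minimum_of_dominating_subset)
    show "finite ?T"
      unfolding T using finite_boolean_vecs by blast
    show "?T \<subseteq> ?S"
      unfolding T by blast
    show "\<exists>t\<in>?T. t \<le> s" if "s \<in> ?S" for s
      unfolding T using that round by blast
  qed
  then obtain v where S_min: "is_minimum ?S v" and T_min: "is_minimum ?T v"
    by blast
  have "\<exists>y \<in> boolean_vecs n. is_arg_min (\<lambda>x. c \<bullet> x) (\<lambda>x. x \<in> F) y" if "F \<noteq> {}"
  proof -
    have ne: "?S \<noteq> {}" "?T \<noteq> {}"
      using that round unfolding T by blast+
    then obtain y where y: "y \<in> F \<inter> boolean_vecs n" "v = ereal (c \<bullet> y)"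
      using T_min unfolding T is_minimum_def by auto
    moreover have "\<forall>x\<in>F. c \<bullet> y \<le> c \<bullet> x"
      using S_min ne(1) y(2) unfolding is_minimum_def by auto
    ultimately show ?thesis
      by (auto simp: is_arg_min_linorder)
  qed
  then show ?thesis
    using round S_min T_min by blast
qed

end
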